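(* Let $L,s,k$ be positive integers such that $L\ge 2s^3+5s^2+1$ and $L\le k\le s+L$. Then for every integer $n\ge 2s^5+8s^4+s^3-14s^2+3s+1$, \[ f_{L,s,k}(n)\ge c_{L,s,2}(n). \]
   Context: For positive integers $L,s,n$: $c_{L,s,2}(n)$ denotes the number of partitions of $n$ all of whose parts lie in $\{s+1,\ldots,s+L\}$. For positive integers $L,s,k,n$: $f_{L,s,k}(n)$ denotes the number of partitions of $n$ whose smallest part equals $s$, whose largest part is at most $L+s$, and which have no part equal to $k$. *)

theory Defs
  imports Complex_Main "HOL-Library.Multiset"
begin

definition partitions_of :: "nat \<Rightarrow> nat multiset set" where
  "partitions_of n = {P. (\<forall>p \<in># P. p > 0) \<and> \<Sum>\<^sub># P = n}"

lemma finite_partitions_of: "finite (partitions_of n)"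
proof (rule finite_subset)
  show "partitions_of n \<subseteq> mset ` {xs. set xs \<subseteq> {..n} \<and> length xs \<le> n}"
  proof
    fix P assume "P \<in> partitions_of n"
    then have pos: "\<forall>p \<in># P. p > 0" and sum: "\<Sum>\<^sub># P = n"
      by (auto simp: partitions_of_def)
    obtain xs where xs: "P = mset xs"
      by (metis ex_mset)
    have "\<forall>x \<in> set xs. x > 0 \<Longrightarrow> length xs \<le> sum_list xs"
      by (induction xs) auto
    then have "length xs \<le> n"
      using pos sum xs by (simp add: sum_mset_sum_list)
    moreover have "set xs \<subseteq> {..n}"
      using sum xs member_le_sum_list by (auto simp: sum_mset_sum_list)
    ultimately show "P \<in> mset ` {xs. set xs \<subseteq> {..n} \<and> length xs \<le> n}"
      using xs by blast
  qed
  show "finite (mset ` {xs. set xs \<subseteq> {..n} \<and> length xs \<le> n})"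
    using finite_lists_length_le[of "{..n}" n] by simp
qed

text \<open>\<open>num_c2 L s n\<close> is the quantity $c_{L,s,2}(n)$.\<close>

definition num_c2 :: "nat \<Rightarrow> nat \<Rightarrow> nat \<Rightarrow> nat" where
  "num_c2 L s n = card {P \<in> partitions_of n. set_mset P \<subseteq> {s + 1..s + L}}"

text \<open>The empty partition has no smallest part, so it is excluded explicitly;
  \<open>Min\<close> and \<open>Max\<close> are unspecified on the empty set.\<close>

definition num_f :: "nat \<Rightarrow> nat \<Rightarrow> nat \<Rightarrow> nat \<Rightarrow> nat" where
  "num_f L s k n = card {P \<in> partitions_of n.
     P \<noteq> {#} \<and> Min (set_mset P) = s \<and> Max (set_mset P) \<le> L + s \<and> k \<notin># P}"

end

theory Submission
  imports Defs
begin

text \<open>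
  Let \<open>D(m)\<close> count the partitions of \<open>m\<close> into parts from \<open>{s+1..s+L} - {k}\<close>. Splitting off the parts
  \<open>k\<close> and \<open>s\<close> respectively, \<open>c(n) = \<Sum>m\<ge>0. D(n - m k)\<close> and \<open>f(n) = \<Sum>j\<ge>1. D(n - j s)\<close>. Adding a part shows
  \<open>D(y) \<le> D(y + z)\<close> for \<open>s < z < 2 s\<close>, so each term with \<open>m \<ge> 1\<close> is dominated by a term of its own with
  \<open>j > (s+1)(s+2)\<close>, and it remains to bound \<open>D(n)\<close> by the terms with \<open>1 \<le> j \<le> (s+1)(s+2)\<close>.

  Write a partition counted by \<open>D(n)\<close> as \<open>x\<close> parts \<open>s+1\<close> together with a partition \<open>P\<close> into larger
  parts. A term \<open>j\<close> counts pairs of a partition \<open>P\<close> and a slot, i.e. a representation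
  \<open>n - |P| = j s + y (s+1)\<close>. The partitions counted by \<open>D(n)\<close> are of three kinds.
  If \<open>x \<ge> s\<close>, keep \<open>P\<close>. If \<open>x < s\<close> and some part \<open>b\<close> of \<open>P\<close> occurs \<open>s\<close> times,
  remove \<open>s\<close> copies of it: \<open>x\<close> and \<open>b\<close> are recovered from \<open>s b + x (s+1)\<close>. These two kinds need one slot
  each. In the remaining case remove a single part \<open>b\<close>: the result
  determines \<open>b\<close> up to the \<open>s\<close> possible values of \<open>x\<close>, so double counting succeeds as soon as the spare
  slots obtained from all distinct parts \<open>b\<close> add up to at least \<open>s\<close>. Since no part occurs \<open>s\<close> times, this
  can fail only if \<open>n\<close> is below the stated bound.
\<close>

section \<open>Partitions with parts in a given set, and splitting off one part size\<close>

definition parts_in :: "nat set \<Rightarrow> nat \<Rightarrow> nat multiset set" where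
  "parts_in S n = {P. set_mset P \<subseteq> S \<and> \<Sum>\<^sub># P = n}"

lemma finite_parts_in:
  assumes "0 \<notin> S"
  shows "finite (parts_in S n)"
proof (rule finite_subset[OF _ finite_partitions_of[of n]])
  show "parts_in S n \<subseteq> partitions_of n"
    using assms by (auto simp: parts_in_def partitions_of_def subset_iff intro: gr0I)
qed

lemma card_filter_eq_sum:
  "finite A \<Longrightarrow> card {x \<in> A. P x} = (\<Sum>x\<in>A. of_bool (P x))"
  by (simp add: Int_def)

text \<open>Removing all copies of \<open>a\<close> sorts the partitions by its multiplicity. The
  predicate \<open>R\<close> lets one identity serve both expansions: any multiplicity for
  \<open>k\<close>, at least one for \<open>s\<close>.\<close>

lemma card_parts_in_insert_count:
  assumes "0 \<notin> S" "a \<notin> S" "a > 0"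
  shows "card {P \<in> parts_in (insert a S) n. R (count P a)} =
    (\<Sum>x | R x \<and> x * a \<le> n. card (parts_in S (n - x * a)))"
proof -
  let ?I = "{x. R x \<and> x * a \<le> n}"
  let ?f = "\<lambda>x Q. Q + replicate_mset x a"
  have "x \<le> n" if "x * a \<le> n" for x
    using that \<open>a > 0\<close> by (metis le_trans mult_le_mono2 nat_mult_1_right Suc_leI One_nat_def)
  then have fin: "finite ?I"
    by (auto intro: finite_subset[of _ "{..n}"])
  have cnt: "count Q a = 0" if "Q \<in> parts_in S m" for Q m
    using that \<open>a \<notin> S\<close> by (auto simp: parts_in_def count_eq_zero_iff)
  have union: "{P \<in> parts_in (insert a S) n. R (count P a)} = (\<Union>x\<in>?I. ?f x ` parts_in S (n - x * a))"
  proof (intro equalityI subsetI)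
    fix P assume P: "P \<in> {P \<in> parts_in (insert a S) n. R (count P a)}"
    define Q where "Q = filter_mset (\<lambda>y. y \<noteq> a) P"
    have PQ: "P = ?f (count P a) Q"
      unfolding Q_def by (rule multiset_eqI) auto
    have "\<Sum>\<^sub># P = \<Sum>\<^sub># Q + count P a * a"
      by (subst PQ) simp
    then have "count P a \<in> ?I" "Q \<in> parts_in S (n - count P a * a)"
      using P by (auto simp: parts_in_def Q_def)
    then show "P \<in> (\<Union>x\<in>?I. ?f x ` parts_in S (n - x * a))"
      using PQ by blast
  next
    fix P assume "P \<in> (\<Union>x\<in>?I. ?f x ` parts_in S (n - x * a))"
    then obtain x Q where "R x" "x * a \<le> n" "Q \<in> parts_in S (n - x * a)" "P = ?f x Q"
      by blast
    then show "P \<in> {P \<in> parts_in (insert a S) n. R (count P a)}"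
      using cnt[of Q] by (auto simp: parts_in_def)
  qed
  have "card (\<Union>x\<in>?I. ?f x ` parts_in S (n - x * a)) = (\<Sum>x\<in>?I. card (?f x ` parts_in S (n - x * a)))"
  proof (rule card_UN_disjoint)
    show "\<forall>x\<in>?I. \<forall>y\<in>?I. x \<noteq> y \<longrightarrow>
        ?f x ` parts_in S (n - x * a) \<inter> ?f y ` parts_in S (n - y * a) = {}"
    proof (intro ballI impI)
      fix x y :: nat assume "x \<noteq> y"
      have c: "count P a = z" if "P \<in> ?f z ` parts_in S (n - z * a)" for P z
        using that cnt by auto
      show "?f x ` parts_in S (n - x * a) \<inter> ?f y ` parts_in S (n - y * a) = {}"
      proof (rule equals0I, erule IntE)
        fix P assume "P \<in> ?f x ` parts_in S (n - x * a)" "P \<in> ?f y ` parts_in S (n - y * a)"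
        then show False using c[of P x] c[of P y] \<open>x \<noteq> y\<close> by simp
      qed
    qed
  qed (use fin finite_parts_in[OF assms(1)] in blast)+
  also have "\<dots> = (\<Sum>x\<in>?I. card (parts_in S (n - x * a)))"
    by (intro sum.cong refl card_image inj_onI) simp
  finally show ?thesis by (simp only: union)
qed

text \<open>The other parts and the total weight determine the multiplicity of \<open>a\<close>, so
  deleting all its copies is a bijection. Counts for different weights thus become conditions on one
  common set of partitions, as the double counting requires.\<close>

lemma card_parts_in_insert_dvd:
  assumes "a \<notin> S" "a > 0"
  shows "card (parts_in (insert a S) n) =
    card {P. set_mset P \<subseteq> S \<and> \<Sum>\<^sub># P \<le> n \<and> a dvd n - \<Sum>\<^sub># P}"
proof -
  let ?f = "filter_mset (\<lambda>y. y \<noteq> a)"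
  let ?g = "\<lambda>P. P + replicate_mset ((n - \<Sum>\<^sub># P) div a) a"
  let ?X = "parts_in (insert a S) n"
  let ?Y = "{P. set_mset P \<subseteq> S \<and> \<Sum>\<^sub># P \<le> n \<and> a dvd n - \<Sum>\<^sub># P}"
  have split: "P = ?f P + replicate_mset (count P a) a" for P
    by (rule multiset_eqI) auto
  have sum: "\<Sum>\<^sub># P = \<Sum>\<^sub># (?f P) + count P a * a" for P
    by (subst split[of P]) (simp only: sum_mset.union sum_mset_replicate_mset of_nat_id)
  have X: "\<Sum>\<^sub># (?f P) \<le> n" "n - \<Sum>\<^sub># (?f P) = count P a * a" if "P \<in> ?X" for P
    using sum[of P] that by (auto simp: parts_in_def)
  have "bij_betw ?f ?X ?Y"
  proof (rule bij_betw_byWitness[where f' = ?g])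
    show "\<forall>P\<in>?X. ?g (?f P) = P"
      using X split \<open>a > 0\<close> by (metis nonzero_mult_div_cancel_right less_not_refl)
    show "\<forall>P\<in>?Y. ?f (?g P) = P"
    proof
      fix P assume "P \<in> ?Y"
      then have "a \<notin># P" using \<open>a \<notin> S\<close> by auto
      then have "count P a = 0" by (simp add: count_eq_zero_iff)
      then show "?f (?g P) = P" by (intro multiset_eqI) auto
    qed
    show "?f ` ?X \<subseteq> ?Y"
      using X by (auto simp: parts_in_def)
    show "?g ` ?Y \<subseteq> ?X"
      by (auto simp: parts_in_def split: if_splits)
  qed
  then show ?thesis by (rule bij_betw_same_card)
qed

lemma card_parts_in_mono_add:
  assumes "0 \<notin> S" "z \<in> S"
  shows "card (parts_in S m) \<le> card (parts_in S (m + z))"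
proof (rule card_inj_on_le[of "add_mset z"])
  show "add_mset z ` parts_in S m \<subseteq> parts_in S (m + z)"
    using assms by (auto simp: parts_in_def)
qed (use finite_parts_in[OF assms(1)] in \<open>auto simp: inj_on_def\<close>)

lemma sum_mset_eq_sum_count: "\<Sum>\<^sub># P = (\<Sum>b\<in>set_mset P. count P b * (b::nat))"
proof (induction P)
  case (add x P)
  have "(\<Sum>b\<in>set_mset (add_mset x P). count (add_mset x P) b * b) =
      (\<Sum>b\<in>insert x (set_mset P). count P b * b + (if b = x then x else 0))"
    by (intro sum.cong) auto
  also have "\<dots> = (\<Sum>b\<in>insert x (set_mset P). count P b * b) + x"
    by (simp add: sum.distrib)
  also have "(\<Sum>b\<in>insert x (set_mset P). count P b * b) = (\<Sum>b\<in>set_mset P. count P b * b)"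
    by (intro sum.mono_neutral_right) (auto simp: count_eq_zero_iff)
  finally show ?case using add by simp
qed simp

section \<open>Slots available to a remainder\<close>

definition slots :: "nat \<Rightarrow> nat \<Rightarrow> nat" where
  "slots s R = card {j \<in> {1..(s + 1) * (s + 2)}. j * s \<le> R \<and> (s + 1) dvd R - j * s}"

text \<open>A lower bound for \<^term>\<open>slots s R\<close> minus the slots reserved for the first two of the
  three kinds of partitions.\<close>

definition spare :: "nat \<Rightarrow> nat \<Rightarrow> nat" where
  "spare s R = min (R div (s * (s + 1))) (s + 2) - (if (s + 1) dvd R then 2 else 1)"

text \<open>Modulo s + 1, s is -1, so slots are the j congruent to -R with j s at most R. Each block
  of s + 1 consecutive positive j contains one such residue, \<open>j t\<close> being the one in
  block t; the range up to (s + 1)(s + 2) consists of s + 2 blocks.\<close>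

lemma slots_ge:
  assumes "s > 0"
  shows "min (R div (s * (s + 1))) (s + 2) \<le> slots s R"
proof -
  define q where "q = min (R div (s * (s + 1))) (s + 2)"
  define j where "j t = (s + 1 - R mod (s + 1)) + t * (s + 1)" for t
  have lt: "R mod (s + 1) < s + 1" by simp
  have "inj_on j {..<q}"
    unfolding j_def by (intro inj_onI) (metis add_left_imp_eq mult_right_cancel add_is_0 one_neq_zero)
  moreover have "j ` {..<q} \<subseteq> {j \<in> {1..(s + 1) * (s + 2)}. j * s \<le> R \<and> (s + 1) dvd R - j * s}"
  proof clarify
    fix t assume "t < q"
    then have t: "t + 1 \<le> R div (s * (s + 1))" "t + 1 \<le> s + 2"
      by (auto simp: q_def)
    have j1: "j t \<ge> 1" using lt unfolding j_def by linarith
    have j2: "j t \<le> (t + 1) * (s + 1)" unfolding j_def by simp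
    have "(t + 1) * (s * (s + 1)) \<le> R"
      using t(1) by (metis div_times_less_eq_dividend le_trans mult_le_mono1)
    moreover have "j t * s \<le> (t + 1) * (s + 1) * s" using j2 by (rule mult_le_mono1)
    ultimately have j3: "j t * s \<le> R" by (simp add: algebra_simps)
    have j4: "j t \<le> (s + 1) * (s + 2)"
      using j2 mult_le_mono1[OF t(2), of "s + 1"] by (simp add: ac_simps)
    have "R + j t = (R div (s + 1)) * (s + 1) + (s + 1) + t * (s + 1)"
      using div_mult_mod_eq[of R "s + 1"] lt unfolding j_def by linarith
    also have "\<dots> = (R div (s + 1) + 1 + t) * (s + 1)" by (simp add: algebra_simps)
    finally have "(s + 1) dvd R + j t" by (metis dvd_triv_right)
    moreover have "R + j t = (R - j t * s) + j t * (s + 1)"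
      using j3 by (simp add: algebra_simps)
    ultimately have "(s + 1) dvd R - j t * s"
      by (metis dvd_add_left_iff dvd_triv_right)
    then show "j t \<in> {1..(s + 1) * (s + 2)} \<and> j t * s \<le> R \<and> (s + 1) dvd R - j t * s"
      using j1 j3 j4 by simp
  qed
  ultimately have "card {..<q} \<le> slots s R"
    unfolding slots_def by (intro card_inj_on_le) auto
  then show ?thesis by (simp add: q_def)
qed

text \<open>The indicators are the slots reserved for many copies of s + 1 and for a part repeated s
  times. If s + 1 does not divide R, only the second can occur, hence the 1 instead of 2 in
  \<open>spare\<close>.\<close>

lemma spare_le_slots:
  assumes "s > 0"
  shows "of_bool ((s + 1) dvd R \<and> s * (s + 1) \<le> R)
     + of_bool (\<exists>b x. s + 2 \<le> b \<and> x < s \<and> R = s * b + x * (s + 1))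
     + spare s R \<le> slots s R"
proof -
  let ?A = "(s + 1) dvd R \<and> s * (s + 1) \<le> R"
  let ?B = "\<exists>b x. s + 2 \<le> b \<and> x < s \<and> R = s * b + x * (s + 1)"
  let ?m = "min (R div (s * (s + 1))) (s + 2)"
  have U: "s * (s + 1) > 0" using assms by simp
  have B1: "s * (s + 1) \<le> R" if B: ?B
  proof -
    obtain b x where "s + 2 \<le> b" "R = s * b + x * (s + 1)" using B by blast
    then have "s * (s + 1) \<le> s * b" by (intro mult_le_mono2) simp
    then show ?thesis using \<open>R = _\<close> by simp
  qed
  \<comment> \<open>When both reservations can meet, b is a multiple of s + 1 larger than s + 1,
    which leaves room for two slots.\<close>
  have B2: "2 * (s * (s + 1)) \<le> R" if B: ?B and dvd: "(s + 1) dvd R"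
  proof -
    obtain b x where b: "s + 2 \<le> b" "R = s * b + x * (s + 1)" using B by blast
    then have "(s + 1) dvd s * b"
      using dvd by (metis dvd_add_left_iff dvd_triv_right)
    moreover have "coprime (s + 1) s" by simp
    ultimately have "(s + 1) dvd b" by (simp add: coprime_dvd_mult_right_iff)
    then obtain i where i: "b = (s + 1) * i" by blast
    then have "i \<noteq> 0" "i \<noteq> 1" using b(1) by (auto intro: gr0I)
    then have "2 * (s + 1) \<le> b" using i by (metis mult.commute mult_le_mono2 less_2_cases not_le One_nat_def)
    then have "s * (2 * (s + 1)) \<le> s * b" by (rule mult_le_mono2)
    then show ?thesis using b(2) by (simp add: ac_simps)
  qed
  have m1: "1 \<le> ?m" if "s * (s + 1) \<le> R"
    using that U by (simp add: less_eq_div_iff_mult_less_eq Suc_le_eq div_greater_zero_iff)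
  have m2: "2 \<le> ?m" if "2 * (s * (s + 1)) \<le> R"
    using that U by (simp add: less_eq_div_iff_mult_less_eq)
  \<comment> \<open>The subtraction is truncated, so the reserved number must be bounded both by
    \<open>?m\<close> and by the constant subtracted.\<close>
  have "of_bool ?A + of_bool ?B + (?m - (if (s + 1) dvd R then 2 else 1)) \<le> ?m"
  proof (cases "(s + 1) dvd R")
    case True
    have "of_bool ?A + of_bool ?B \<le> ?m"
    proof (cases ?B)
      case B: True
      have "of_bool ?A + of_bool ?B \<le> (2::nat)" by (simp add: of_bool_def)
      then show ?thesis using m2[OF B2[OF B True]] by (rule order_trans)
    next
      case False
      then show ?thesis using m1 by (simp only: of_bool_def if_False split: if_split) simp
    qed
    moreover have "of_bool ?A + of_bool ?B \<le> (2::nat)" by (simp add: of_bool_def)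
    ultimately show ?thesis using True by (simp only: if_True)
  next
    case False
    have "of_bool ?B \<le> ?m"
      using m1[OF B1] by (cases ?B) (simp_all only: of_bool_eq zero_le)
    moreover have "of_bool ?B \<le> (1::nat)" by (simp add: of_bool_def)
    moreover have "of_bool ?A = (0::nat)" using False by simp
    ultimately show ?thesis using False by (simp only: if_False)
  qed
  then show ?thesis
    using slots_ge[OF assms, of R] unfolding spare_def by linarith
qed

section \<open>Spare slots of a partition of large weight\<close>

text \<open>Up to an additive term of bounded total over all \<open>b\<close>, the spare slots gained by removing a part
  \<open>b\<close> grow linearly in \<open>b\<close>; a partition of large weight therefore finds many of them.\<close>

lemma le_spare:
  assumes s: "s > 0" and r: "(s + 1) dvd r" and small: "spare s (r + b) < s"
  defines "U \<equiv> s * (s + 1)"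
  shows "b \<le> 3 * U * spare s (r + b)
     + (if b < 2 * U then b else 0)
     + (if b \<in> (\<lambda>i. (2 * s + i) * (s + 1)) ` {..<s} then b else 0)
     + (if b \<in> (\<lambda>i. (3 * s + i) * (s + 1)) ` {..<s} then b - 3 * U else 0)"
proof -
  define q where "q = b div U"
  define w where "w = spare s (r + b)"
  have U: "U > 0" using s by (simp add: U_def)
  have dvd: "(s + 1) dvd r + b \<longleftrightarrow> (s + 1) dvd b"
    using r by (simp add: dvd_add_right_iff)
  have "b div U \<le> (r + b) div U" by (simp add: div_le_mono)
  \<comment> \<open>\<open>small\<close> excludes the cap s + 2 in \<open>spare\<close>, since the
    cap minus 2 is already s; so the quotient is the minimum.\<close>
  then have w: "q - (if (s + 1) dvd b then 2 else 1) \<le> w"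
    using small unfolding w_def spare_def U_def[symmetric] q_def dvd
    by (auto simp: min_def split: if_splits)
  have b1: "b < (q + 1) * U"
    using dividend_less_div_times[OF U, of b] by (simp add: q_def algebra_simps)
  have b2: "q * U \<le> b"
    by (simp add: q_def)
  \<comment> \<open>The factor 3: w \<ge> q - 1 yields q + 1 \<le> 3 w once q \<ge> 2, and w \<ge> q
    - 2 yields it once q \<ge> 4. This leaves b < 2 U and the multiples of s + 1 with q = 2 or q =
    3. For q = 3, w \<ge> 1 already pays for 3 U.\<close>
  have scale: "b \<le> 3 * U * w" if "q + 1 \<le> 3 * w"
    using b1 mult_le_mono1[OF that, of U] by (simp add: ac_simps)
  have lt2: "b < 2 * U" if "q < 2"
    using b1 mult_le_mono1[of "q + 1" 2 U] that by linarith
  show ?thesis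
  proof (cases "q < 2")
    case True
    then show ?thesis using lt2 by simp
  next
    case q2: False
    show ?thesis
    proof (cases "(s + 1) dvd b")
      case False
      then have "q + 1 \<le> 3 * w" using w q2 by simp
      then show ?thesis using scale unfolding w_def by simp
    next
      case True
      then obtain i where i: "b = i * (s + 1)" by (metis dvd_def mult.commute)
      have "i * (s + 1) < ((q + 1) * s) * (s + 1)" "(q * s) * (s + 1) \<le> i * (s + 1)"
        using b1 b2 unfolding i U_def by (simp_all only: mult.assoc)
      then have iq: "i < (q + 1) * s" "q * s \<le> i"
        using mult_less_cancel2 mult_le_cancel2 by (blast, metis add_gr_0 zero_less_one)
      then have iq': "i = q * s + (i - q * s)" "i - q * s < s"
        by (simp_all add: less_diff_conv2)
      consider "q = 2" | "q = 3" | "q \<ge> 4" using q2 by linarith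
      then show ?thesis
      proof cases
        case 1
        then have "b = (2 * s + (i - 2 * s)) * (s + 1)" "i - 2 * s \<in> {..<s}"
          using iq' i by simp_all
        then have "b \<in> (\<lambda>i. (2 * s + i) * (s + 1)) ` {..<s}" by (rule image_eqI)
        then show ?thesis by simp
      next
        case 2
        then have "b = (3 * s + (i - 3 * s)) * (s + 1)" "i - 3 * s \<in> {..<s}"
          using iq' i by simp_all
        then have "b \<in> (\<lambda>i. (3 * s + i) * (s + 1)) ` {..<s}" by (rule image_eqI)
        moreover have "3 * U \<le> b" using b2 2 by simp
        moreover have "1 \<le> w" using w True 2 by simp
        then have "3 * U * 1 \<le> 3 * U * w" by (rule mult_le_mono2)
        ultimately show ?thesis unfolding w_def by (simp only: if_True)
      next
        case 3
        then have "q + 1 \<le> 3 * w" using w True by simp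
        then show ?thesis using scale unfolding w_def by simp
      qed
    qed
  qed
qed

text \<open>If the total were below s, \<open>le_spare\<close> would bound the sum of the distinct
  parts; as each occurs at most s - 1 times, the whole weight would stay below the
  polynomial.\<close>

lemma sum_spare_ge:
  assumes s: "s > 0" and r: "(s + 1) dvd r" "r < s * (s + 1)"
    and P: "\<And>b. b \<in># P \<Longrightarrow> s + 2 \<le> b \<and> count P b < s"
    and n: "int (r + \<Sum>\<^sub># P) \<ge>
      2 * int s ^ 5 + 8 * int s ^ 4 + int s ^ 3 - 14 * int s ^ 2 + 3 * int s + 1"
  shows "s \<le> (\<Sum>b\<in>set_mset P. spare s (r + b))"
proof (rule ccontr)
  define U where "U = s * (s + 1)"
  define W where "W = (\<Sum>b\<in>set_mset P. spare s (r + b))"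
  define c1 where "c1 b = (if b < 2 * U then b else 0)" for b
  define c2 where "c2 b = (if b \<in> (\<lambda>i. (2 * s + i) * (s + 1)) ` {..<s} then b else 0)" for b
  define c3 where "c3 b = (if b \<in> (\<lambda>i. (3 * s + i) * (s + 1)) ` {..<s} then b - 3 * U else 0)" for b
  assume "\<not> s \<le> (\<Sum>b\<in>set_mset P. spare s (r + b))"
  then have W: "W \<le> s - 1" unfolding W_def by simp
  have inj: "inj_on (\<lambda>i. (c + i) * (s + 1)) A" for A c
    by (intro inj_onI) (metis add_left_imp_eq mult_right_cancel add_is_0 one_neq_zero)
  have gauss: "2 * (\<Sum>i<m. i) + m = m * m" for m :: nat
    by (induction m) auto
  have "spare s (r + b) < s" if "b \<in># P" for b
  proof -
    have "spare s (r + b) \<le> W"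
      unfolding W_def using that by (intro member_le_sum) auto
    then show ?thesis using W s by simp
  qed
  then have "(\<Sum>b\<in>set_mset P. b) \<le> (\<Sum>b\<in>set_mset P. 3 * U * spare s (r + b) + c1 b + c2 b + c3 b)"
    using le_spare[OF s r(1)] unfolding U_def c1_def c2_def c3_def by (intro sum_mono) blast
  also have "\<dots> = 3 * U * W + sum c1 (set_mset P) + sum c2 (set_mset P) + sum c3 (set_mset P)"
    by (simp add: sum.distrib sum_distrib_left W_def)
  finally have 0: "(\<Sum>b\<in>set_mset P. b) \<le> \<dots>" .
  \<comment> \<open>Distinct parts below 2 U, none smaller than s + 2, sum to at most the sum of all
    integers in that range.\<close>
  have 1: "sum c1 (set_mset P) + (\<Sum>b<s + 2. b) \<le> (\<Sum>b<2 * U. b)"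
  proof -
    let ?B = "{b \<in> set_mset P. b < 2 * U}"
    have "s + 2 \<le> 2 * U" using s by (cases s) (auto simp: U_def)
    have "sum c1 (set_mset P) = sum c1 ?B"
      by (intro sum.mono_neutral_right) (auto simp: c1_def)
    also have "\<dots> = \<Sum>?B"
      by (intro sum.cong) (auto simp: c1_def)
    also have "\<Sum>?B + \<Sum>{..<s + 2} = \<Sum>(?B \<union> {..<s + 2})"
      using P by (intro sum.union_disjoint[symmetric]) (auto dest: leD)
    also have "\<dots> \<le> \<Sum>{..<2 * U}"
      using \<open>s + 2 \<le> 2 * U\<close> by (intro sum_mono2) auto
    finally show ?thesis .
  qed
  \<comment> \<open>Only s multiples of s + 1 have quotient 2, and likewise 3; the worst case is
    that all of them occur.\<close>
  have 2: "sum c2 (set_mset P) \<le> (\<Sum>i<s. (2 * s + i) * (s + 1))"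
  proof -
    let ?I = "(\<lambda>i. (2 * s + i) * (s + 1)) ` {..<s}"
    have "sum c2 (set_mset P) = sum c2 (set_mset P \<inter> ?I)"
      by (intro sum.mono_neutral_right) (auto simp: c2_def)
    also have "\<dots> \<le> sum c2 ?I"
      by (intro sum_mono2) auto
    also have "\<dots> = (\<Sum>i<s. c2 ((2 * s + i) * (s + 1)))"
      by (subst sum.reindex[OF inj]) (simp add: o_def)
    also have "\<dots> \<le> (\<Sum>i<s. (2 * s + i) * (s + 1))"
      by (intro sum_mono) (simp only: c2_def split: if_split, simp)
    finally show ?thesis .
  qed
  have 3: "sum c3 (set_mset P) \<le> (\<Sum>i<s. i * (s + 1))"
  proof -
    let ?I = "(\<lambda>i. (3 * s + i) * (s + 1)) ` {..<s}"
    have "sum c3 (set_mset P) = sum c3 (set_mset P \<inter> ?I)"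
      by (intro sum.mono_neutral_right) (auto simp: c3_def)
    also have "\<dots> \<le> sum c3 ?I"
      by (intro sum_mono2) auto
    also have "\<dots> = (\<Sum>i<s. c3 ((3 * s + i) * (s + 1)))"
      by (subst sum.reindex[OF inj]) (simp add: o_def)
    also have "\<dots> \<le> (\<Sum>i<s. (3 * s + i) * (s + 1) - 3 * U)"
      by (intro sum_mono) (simp only: c3_def split: if_split, simp)
    also have "\<dots> = (\<Sum>i<s. i * (s + 1))"
      by (intro sum.cong refl) (simp add: U_def algebra_simps)
    finally show ?thesis .
  qed
  have 4: "r \<le> (s - 1) * (s + 1)"
  proof -
    obtain x where x: "r = (s + 1) * x" using r(1) by blast
    then have "x < s" using r(2) by (metis mult.commute mult_less_cancel2)
    then have "x \<le> s - 1" by simp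
    then show ?thesis using x by (metis mult.commute mult_le_mono1)
  qed
  have 5: "\<Sum>\<^sub># P \<le> (s - 1) * (\<Sum>b\<in>set_mset P. b)"
  proof -
    have "count P b * b \<le> (s - 1) * b" if "b \<in># P" for b
      using P[OF that] by (intro mult_le_mono1) linarith
    then show ?thesis
      unfolding sum_mset_eq_sum_count[of P] sum_distrib_left by (rule sum_mono)
  qed
  \<comment> \<open>With s = t + 1 the truncated s - 1 disappears and both polynomials finally
    compared have nonnegative coefficients.\<close>
  obtain t where t: "s = t + 1" using s by (metis Suc_eq_plus1 gr0_implies_Suc)
  define X where "X = (\<Sum>b\<in>set_mset P. b)"
  define G where "G = (\<Sum>i<s. i)"
  have e2: "(\<Sum>i<s. (2 * s + i) * (s + 1)) = (2 * s * s + G) * (s + 1)"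
    unfolding G_def by (simp only: sum_distrib_right[symmetric] sum.distrib) simp
  have e3: "(\<Sum>i<s. i * (s + 1)) = G * (s + 1)"
    unfolding G_def by (simp only: sum_distrib_right)
  have U: "int U = int t ^ 2 + 3 * int t + 2"
    by (simp add: U_def t algebra_simps power2_eq_square)
  have W': "int (3 * U * W) \<le> int (3 * U * t)"
    using W unfolding t of_nat_le_iff by (intro mult_le_mono2) simp
  have "2 * int X \<le> 4 * int t ^ 4 + 36 * int t ^ 3 + 89 * int t ^ 2 + 73 * int t + 14"
  proof -
    have "2 * G = t * (t + 1)"
      using gauss[of s] unfolding G_def t by simp
    then have G: "2 * int G = int t ^ 2 + int t"
      by (simp add: power2_eq_square algebra_simps flip: of_nat_mult of_nat_add)
    have G1: "2 * int (\<Sum>b<s + 2. b) = int t ^ 2 + 5 * int t + 6"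
      using arg_cong[OF gauss[of "s + 2"], of int] unfolding t
      by (simp only: of_nat_add of_nat_mult of_nat_numeral of_nat_1) (simp add: algebra_simps power2_eq_square)
    have "2 * int (\<Sum>b<2 * U. b) = 2 * int U * (2 * int U) - 2 * int U"
      using arg_cong[OF gauss[of "2 * U"], of int]
      by (simp only: of_nat_add of_nat_mult of_nat_numeral)
    also have "\<dots> = 4 * int t ^ 4 + 24 * int t ^ 3 + 50 * int t ^ 2 + 42 * int t + 12"
      unfolding U by (simp add: algebra_simps power_numeral_reduce)
    finally have G2: "2 * int (\<Sum>b<2 * U. b) = \<dots>" .
    have C2: "2 * int ((2 * s * s + G) * (s + 1)) = (4 * (int t + 1) ^ 2 + 2 * int G) * (int t + 2)"
      by (simp add: t algebra_simps power2_eq_square)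
    have C3: "2 * int (G * (s + 1)) = 2 * int G * (int t + 2)"
      by (simp add: t algebra_simps)
    have C1: "int (3 * U * t) = 3 * (int t ^ 2 + 3 * int t + 2) * int t"
      using U by simp
    have "int X \<le> int (3 * U * W) + int (sum c1 (set_mset P)) + int (sum c2 (set_mset P))
        + int (sum c3 (set_mset P))"
      using 0 unfolding X_def by (simp only: of_nat_add[symmetric] of_nat_le_iff)
    moreover have "int (sum c1 (set_mset P)) + int (\<Sum>b<s + 2. b) \<le> int (\<Sum>b<2 * U. b)"
      using 1 by (simp only: of_nat_add[symmetric] of_nat_le_iff)
    moreover have "int (sum c2 (set_mset P)) \<le> int ((2 * s * s + G) * (s + 1))"
      using 2 unfolding e2 by (simp only: of_nat_le_iff)
    moreover have "int (sum c3 (set_mset P)) \<le> int (G * (s + 1))"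
      using 3 unfolding e3 by (simp only: of_nat_le_iff)
    ultimately have "2 * int X \<le> 2 * (3 * (int t ^ 2 + 3 * int t + 2) * int t)
        + (4 * int t ^ 4 + 24 * int t ^ 3 + 50 * int t ^ 2 + 42 * int t + 12)
        - (int t ^ 2 + 5 * int t + 6)
        + (4 * (int t + 1) ^ 2 + (int t ^ 2 + int t)) * (int t + 2)
        + (int t ^ 2 + int t) * (int t + 2)"
      using W' G1 G2 C2 C3 unfolding C1 G by linarith
    also have "\<dots> = 4 * int t ^ 4 + 36 * int t ^ 3 + 89 * int t ^ 2 + 73 * int t + 14"
      by (simp add: algebra_simps power_numeral_reduce)
    finally show ?thesis .
  qed
  then have "int t * (2 * int X) \<le>
      int t * (4 * int t ^ 4 + 36 * int t ^ 3 + 89 * int t ^ 2 + 73 * int t + 14)"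
    by (intro mult_left_mono) simp_all
  also have "\<dots> = 4 * int t ^ 5 + 36 * int t ^ 4 + 89 * int t ^ 3 + 73 * int t ^ 2 + 14 * int t"
    by (simp add: algebra_simps power_numeral_reduce)
  finally have "2 * (int t * int X) \<le> \<dots>" by (simp only: mult.left_commute)
  moreover have "r + \<Sum>\<^sub># P \<le> t * (s + 1) + t * X"
    using 4 5 unfolding X_def t by simp
  then have "int (r + \<Sum>\<^sub># P) \<le> int (t * (s + 1) + t * X)"
    by (simp only: of_nat_le_iff)
  then have "int (r + \<Sum>\<^sub># P) \<le> int t ^ 2 + 2 * int t + int t * int X"
    by (simp add: t algebra_simps power2_eq_square)
  \<comment> \<open>Doubled, this and the upper bound on the weight share 4 t^5 + 36 t^4; each lower
    coefficient is larger here, the constant being 2 against 0.\<close>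
  moreover have "2 * int s ^ 5 + 8 * int s ^ 4 + int s ^ 3 - 14 * int s ^ 2 + 3 * int s + 1 =
      2 * int t ^ 5 + 18 * int t ^ 4 + 53 * int t ^ 3 + 57 * int t ^ 2 + 20 * int t + 1"
    by (simp add: t algebra_simps power_numeral_reduce)
  moreover have "int t ^ 3 \<ge> 0" "int t ^ 2 \<ge> 0" "int t \<ge> 0" by simp_all
  ultimately show False using n by linarith
qed


section \<open>Double counting for the term without parts k\<close>

lemma card_parts_in_le_sum:
  assumes s: "s > 0" and S: "\<And>b. b \<in> S \<Longrightarrow> s + 2 \<le> b"
    and n: "int n \<ge> 2 * int s ^ 5 + 8 * int s ^ 4 + int s ^ 3 - 14 * int s ^ 2 + 3 * int s + 1"
  shows "card (parts_in (insert (s + 1) S) n) \<le>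
    (\<Sum>j | j \<in> {1..(s + 1) * (s + 2)} \<and> j * s \<le> n. card (parts_in (insert (s + 1) S) (n - j * s)))"
proof -
  \<comment> \<open>\<open>V\<close> holds the partitions into parts above s + 1, and
    \<open>r P\<close> is the weight left over. Both sides of the claim become weighted counts over
    \<open>V\<close>.\<close>
  define V where "V = {P. set_mset P \<subseteq> S \<and> \<Sum>\<^sub># P \<le> n}"
  define r where "r P = n - \<Sum>\<^sub># P" for P
  let ?J = "{1..(s + 1) * (s + 2)}"
  let ?A = "\<lambda>R. (s + 1) dvd R \<and> s * (s + 1) \<le> R"
  let ?B = "\<lambda>R. \<exists>b x. s + 2 \<le> b \<and> x < s \<and> R = s * b + x * (s + 1)"
  have S0: "0 \<notin> S" and S1: "s + 1 \<notin> S" using S by fastforce+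
  have "V = (\<Union>m\<in>{..n}. parts_in S m)"
    by (auto simp: V_def parts_in_def)
  then have fin: "finite V"
    using finite_parts_in[OF S0] by simp
  have rhs: "(\<Sum>j | j \<in> ?J \<and> j * s \<le> n. card (parts_in (insert (s + 1) S) (n - j * s)))
      = (\<Sum>P\<in>V. slots s (r P))"
  proof -
    have "card (parts_in (insert (s + 1) S) (n - j * s)) =
        (\<Sum>P\<in>V. of_bool (j * s \<le> r P \<and> (s + 1) dvd r P - j * s))" if "j * s \<le> n" for j
    proof -
      have "{P. set_mset P \<subseteq> S \<and> \<Sum>\<^sub># P \<le> n - j * s \<and> (s + 1) dvd n - j * s - \<Sum>\<^sub># P}
          = {P \<in> V. j * s \<le> r P \<and> (s + 1) dvd r P - j * s}"
        using that by (auto simp: V_def r_def add.commute)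
      then have "card (parts_in (insert (s + 1) S) (n - j * s)) =
          card {P \<in> V. j * s \<le> r P \<and> (s + 1) dvd r P - j * s}"
        using card_parts_in_insert_dvd[OF S1, of "n - j * s"] by simp
      also have "\<dots> = (\<Sum>P\<in>V. of_bool (j * s \<le> r P \<and> (s + 1) dvd r P - j * s))"
        using fin by (rule card_filter_eq_sum)
      finally show ?thesis .
    qed
    then have "(\<Sum>j | j \<in> ?J \<and> j * s \<le> n. card (parts_in (insert (s + 1) S) (n - j * s))) =
        (\<Sum>j | j \<in> ?J \<and> j * s \<le> n. \<Sum>P\<in>V. of_bool (j * s \<le> r P \<and> (s + 1) dvd r P - j * s))"
      by (intro sum.cong) auto
    also have "\<dots> = (\<Sum>j\<in>?J. \<Sum>P\<in>V. of_bool (j * s \<le> r P \<and> (s + 1) dvd r P - j * s))"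
    proof (intro sum.mono_neutral_left ballI sum.neutral)
      fix i P assume "i \<in> ?J - {j. j \<in> ?J \<and> j * s \<le> n}"
      then have "\<not> i * s \<le> r P" by (auto simp: r_def)
      then show "of_bool (i * s \<le> r P \<and> (s + 1) dvd r P - i * s) = (0::nat)" by simp
    qed auto
    also have "\<dots> = (\<Sum>P\<in>V. \<Sum>j\<in>?J. of_bool (j * s \<le> r P \<and> (s + 1) dvd r P - j * s))"
      by (rule sum.swap)
    also have "\<dots> = (\<Sum>P\<in>V. slots s (r P))"
      unfolding slots_def by (intro sum.cong refl card_filter_eq_sum[symmetric]) simp
    finally show ?thesis .
  qed
  \<comment> \<open>With x = r P div (s + 1) parts s + 1, the condition r P < s (s + 1) says x <
    s.\<close>
  define XA where "XA = {P \<in> V. ?A (r P)}"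
  define XB where "XB = {P \<in> V. (s + 1) dvd r P \<and> r P < s * (s + 1) \<and> (\<exists>b. s \<le> count P b)}"
  define XD where "XD = {P \<in> V. (s + 1) dvd r P \<and> r P < s * (s + 1) \<and> \<not> (\<exists>b. s \<le> count P b)}"
  have r_eq: "\<exists>x<s. r P = x * (s + 1)" if "(s + 1) dvd r P" "r P < s * (s + 1)" for P
    using that by (metis dvd_def mult.commute mult_less_cancel2)
  have "card (parts_in (insert (s + 1) S) n) = card {P. set_mset P \<subseteq> S \<and> \<Sum>\<^sub># P \<le> n \<and> (s + 1) dvd n - \<Sum>\<^sub># P}"
    by (rule card_parts_in_insert_dvd[OF S1]) simp
  also have "\<dots> = card (XA \<union> XB \<union> XD)"
    by (rule arg_cong[of _ _ card]) (auto simp: V_def r_def XA_def XB_def XD_def not_less)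
  also have "\<dots> \<le> card XA + card XB + card XD"
    by (meson add_le_mono1 card_Un_le le_trans)
  also have "card XA = (\<Sum>P\<in>V. of_bool (?A (r P)))"
    unfolding XA_def using fin by (rule card_filter_eq_sum)
  also have "card XB \<le> (\<Sum>P\<in>V. of_bool (?B (r P)))"
  proof -
    define b where "b P = (SOME b. s \<le> count P b)" for P :: "nat multiset"
    define g where "g P = P - replicate_mset s (b P)" for P
    have XB: "P = g P + replicate_mset s (b P)" "g P \<in> V" "r (g P) = r P + s * b P" "b P \<in> S"
      if "P \<in> XB" for P
    proof -
      have "s \<le> count P (b P)"
        using that unfolding XB_def b_def by (auto intro: someI_ex)
      then show eq: "P = g P + replicate_mset s (b P)"
        by (simp add: g_def count_le_replicate_mset_subset_eq)
      have P: "set_mset P \<subseteq> S" "\<Sum>\<^sub># P \<le> n" using that by (auto simp: XB_def V_def)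
      show "b P \<in> S"
        using \<open>s \<le> count P (b P)\<close> s P(1) by (metis count_inI not_le subsetD)
      have "\<Sum>\<^sub># P = \<Sum>\<^sub># (g P) + s * b P"
        by (subst eq) simp
      moreover have "set_mset (g P) \<subseteq> S"
        using P(1) unfolding g_def by (meson in_diffD subset_iff)
      ultimately show "g P \<in> V" "r (g P) = r P + s * b P"
        using P(2) by (auto simp: V_def r_def)
    qed
    have "inj_on g XB"
    proof (rule inj_onI)
      fix P Q assume PQ: "P \<in> XB" "Q \<in> XB" "g P = g Q"
      obtain x where x: "x < s" "r P = x * (s + 1)" using r_eq PQ(1) by (auto simp: XB_def)
      obtain y where y: "y < s" "r Q = y * (s + 1)" using r_eq PQ(2) by (auto simp: XB_def)
      \<comment> \<open>The new remainder is s (x + b) + x with x < s, so its residue modulo s gives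
        x, and then b follows.\<close>
      have eq: "s * (x + b P) + x = s * (y + b Q) + y"
        using XB(3)[OF PQ(1)] XB(3)[OF PQ(2)] PQ(3) x(2) y(2) by (simp add: algebra_simps)
      then have "x = y"
        using x(1) y(1) by (metis mod_less mod_mult_self4)
      then have "b P = b Q" using eq s by simp
      then show "P = Q" using XB(1)[OF PQ(1)] XB(1)[OF PQ(2)] PQ(3) by simp
    qed
    moreover have "g ` XB \<subseteq> {P \<in> V. ?B (r P)}"
    proof clarify
      fix P assume P: "P \<in> XB"
      obtain x where "x < s" "r P = x * (s + 1)" using r_eq P by (auto simp: XB_def)
      then show "g P \<in> V \<and> ?B (r (g P))"
        using XB[OF P] S[of "b P"] by (metis add.commute)
    qed
    ultimately have "card XB \<le> card {P \<in> V. ?B (r P)}"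
      using fin by (intro card_inj_on_le) auto
    then show ?thesis by (simp only: card_filter_eq_sum[OF fin])
  qed
  also have "card XD \<le> (\<Sum>P\<in>V. spare s (r P))"
  proof -
    \<comment> \<open>\<open>h\<close> keeps the smaller partition and x. Since x gives
      \<open>r P\<close>, b is the growth of the remainder.\<close>
    define Z where "Z = (SIGMA P:XD. set_mset P)"
    define h where "h = (\<lambda>(P, b). (P - {#b#}, r P div (s + 1)))"
    have finD: "finite XD" using fin by (simp add: XD_def)
    have Z: "P - {#b#} \<in> V" "r (P - {#b#}) = r P + b" "P = add_mset b (P - {#b#})"
      "r P = (r P div (s + 1)) * (s + 1)" "r P div (s + 1) < s"
      if "(P, b) \<in> Z" for P b
    proof -
      have "P \<in> XD" and b: "b \<in># P" using that by (auto simp: Z_def)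
      then have P: "set_mset P \<subseteq> S" "\<Sum>\<^sub># P \<le> n" "(s + 1) dvd r P" "r P < s * (s + 1)"
        by (auto simp: XD_def V_def)
      show eq: "P = add_mset b (P - {#b#})" using b by simp
      have "\<Sum>\<^sub># P = b + \<Sum>\<^sub># (P - {#b#})"
        by (subst eq) simp
      moreover have "set_mset (P - {#b#}) \<subseteq> S"
        using P(1) by (meson in_diffD subset_iff)
      ultimately show "P - {#b#} \<in> V" "r (P - {#b#}) = r P + b"
        using P(2) by (auto simp: V_def r_def)
      show "r P = (r P div (s + 1)) * (s + 1)"
        using P(3) by (simp only: dvd_div_mult_self)
      then show "r P div (s + 1) < s" using P(4) by (metis mult_less_cancel2)
    qed
    have inj: "inj_on h Z"
    proof (rule inj_onI, clarify)
      fix P b Q c assume PQ: "(P, b) \<in> Z" "(Q, c) \<in> Z" "h (P, b) = h (Q, c)"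
      then have *: "P - {#b#} = Q - {#c#}" "r P div (s + 1) = r Q div (s + 1)"
        by (simp_all add: h_def)
      have "r P = r Q" using Z(4)[OF PQ(1)] Z(4)[OF PQ(2)] *(2) by metis
      then have "b = c" using Z(2)[OF PQ(1)] Z(2)[OF PQ(2)] *(1) by simp
      then show "P = Q \<and> b = c" using Z(3)[OF PQ(1)] Z(3)[OF PQ(2)] *(1) by metis
    qed
    \<comment> \<open>Each P in \<open>XD\<close> collects at least s spare slots, while each
      smaller partition is reached at most s times; the two factors s cancel.\<close>
    have "s * card XD = (\<Sum>P\<in>XD. s)" by simp
    also have "\<dots> \<le> (\<Sum>P\<in>XD. \<Sum>b\<in>set_mset P. spare s (r P + b))"
    proof (rule sum_mono)
      fix P assume "P \<in> XD"
      then have P: "set_mset P \<subseteq> S" "\<Sum>\<^sub># P \<le> n" "(s + 1) dvd r P" "r P < s * (s + 1)"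
        "\<And>b. count P b < s"
        by (auto simp: XD_def V_def not_le)
      have "r P + \<Sum>\<^sub># P = n" using P(2) by (simp add: r_def)
      then show "s \<le> (\<Sum>b\<in>set_mset P. spare s (r P + b))"
        using n P S by (intro sum_spare_ge[OF s P(3,4)]) auto
    qed
    also have "\<dots> = (\<Sum>(P, b)\<in>Z. spare s (r P + b))"
      unfolding Z_def using finD by (intro sum.Sigma) auto
    also have "\<dots> = (\<Sum>z\<in>Z. spare s (r (fst (h z))))"
      using Z(2) by (intro sum.cong) (auto simp: h_def)
    also have "\<dots> = (\<Sum>z\<in>h ` Z. spare s (r (fst z)))"
      by (simp add: sum.reindex[OF inj])
    also have "\<dots> \<le> (\<Sum>z\<in>V \<times> {..<s}. spare s (r (fst z)))"
      using Z(1,5) fin by (intro sum_mono2) (auto simp: h_def)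
    also have "\<dots> = (\<Sum>P\<in>V. \<Sum>x<s. spare s (r P))"
      by (subst sum.cartesian_product) (simp add: case_prod_unfold)
    also have "\<dots> = s * (\<Sum>P\<in>V. spare s (r P))"
      by (simp add: sum_distrib_left)
    finally show ?thesis using s by simp
  qed
  also have "(\<Sum>P\<in>V. of_bool (?A (r P))) + (\<Sum>P\<in>V. of_bool (?B (r P))) + (\<Sum>P\<in>V. spare s (r P))
      \<le> (\<Sum>P\<in>V. slots s (r P))"
    unfolding sum.distrib[symmetric] by (intro sum_mono spare_le_slots[OF s])
  finally show ?thesis unfolding rhs by simp
qed


section \<open>Matching the two expansions term by term\<close>

theorem theorem2p2:
  fixes L s k n :: nat
  assumes "L > 0" and "s > 0" and "k > 0"
    and "L \<ge> 2 * s ^ 3 + 5 * s ^ 2 + 1"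
    and "L \<le> k" and "k \<le> s + L"
    and "int n \<ge> 2 * int s ^ 5 + 8 * int s ^ 4 + int s ^ 3 - 14 * int s ^ 2 + 3 * int s + 1"
  shows "num_f L s k n \<ge> num_c2 L s n"
proof -
  define T where "T = {s + 1..s + L} - {k}"
  define J where "J = (s + 1) * (s + 2)"
  define c where "c m = card (parts_in T m)" for m
  \<comment> \<open>A nonzero remainder of m k modulo s is too small to be a part. Lowering the
    quotient by 1 makes the gap lie strictly between s and 2 s, hence in \<open>T\<close>.\<close>
  define j where "j m = (if s dvd m * k then m * k div s else m * k div s - 1)" for m
  \<comment> \<open>The + 2 keeps \<open>j m\<close> above \<open>J\<close> even after the quotient
    is lowered by 1. The hypothesis on L gives this with equality for s = 1.\<close>
  have L: "s * (J + 2) \<le> L"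
  proof -
    obtain t where "s = t + 1" using \<open>s > 0\<close> by (metis Suc_eq_plus1 gr0_implies_Suc)
    then have "s * (J + 2) \<le> 2 * s ^ 3 + 5 * s ^ 2 + 1"
      by (simp add: J_def algebra_simps power_numeral_reduce)
    then show ?thesis using assms(4) by simp
  qed
  then have k: "s * (J + 2) \<le> k" using \<open>L \<le> k\<close> by simp
  have "s * 3 \<le> s * (J + 2)" by (intro mult_le_mono2) (simp add: J_def)
  then have k2: "3 * s \<le> k" "3 * s \<le> L" using k L by linarith+
  have T: "0 \<notin> T" "k \<notin> T" "s \<notin> T" "insert k T = {s + 1..s + L}"
    "T = insert (s + 1) ({s + 2..s + L} - {k})"
    using k2 assms by (auto simp: T_def)

  have "num_c2 L s n = card {P \<in> parts_in (insert k T) n. True}"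
    unfolding num_c2_def T(4) parts_in_def partitions_of_def
    by (rule arg_cong[of _ _ card]) auto
  also have "\<dots> = (\<Sum>m | True \<and> m * k \<le> n. c (n - m * k))"
    unfolding c_def by (rule card_parts_in_insert_count[OF T(1,2) \<open>k > 0\<close>])
  finally have C: "num_c2 L s n = (\<Sum>m | m * k \<le> n. c (n - m * k))" by simp

  have "(\<Sum>j | 1 \<le> j \<and> j * s \<le> n. c (n - j * s)) =
      card {P \<in> parts_in (insert s T) n. 1 \<le> count P s}"
    unfolding c_def by (rule card_parts_in_insert_count[OF T(1,3) \<open>s > 0\<close>, symmetric])
  also have "\<dots> \<le> num_f L s k n"
    unfolding num_f_def
  proof (rule card_mono)
    show "finite {P \<in> partitions_of n.
        P \<noteq> {#} \<and> Min (set_mset P) = s \<and> Max (set_mset P) \<le> L + s \<and> k \<notin># P}"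
      by (rule finite_subset[OF _ finite_partitions_of[of n]]) blast
    show "{P \<in> parts_in (insert s T) n. 1 \<le> count P s} \<subseteq> {P \<in> partitions_of n.
        P \<noteq> {#} \<and> Min (set_mset P) = s \<and> Max (set_mset P) \<le> L + s \<and> k \<notin># P}"
    proof clarify
      fix P assume P: "P \<in> parts_in (insert s T) n" "1 \<le> count P s"
      then have sP: "s \<in># P" by (simp add: Suc_le_eq)
      have sub: "set_mset P \<subseteq> insert s T" "\<Sum>\<^sub># P = n" using P by (auto simp: parts_in_def)
      have bnd: "s \<le> p" "p \<le> L + s" "p \<noteq> k" if "p \<in># P" for p
        using that sub k2 \<open>s > 0\<close> by (auto simp: T_def)
      have "Min (set_mset P) = s" using sP bnd by (intro Min_eqI) auto
      moreover have "Max (set_mset P) \<le> L + s" using sP bnd by (subst Max_le_iff) auto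
      moreover have "P \<in> partitions_of n"
        using bnd(1) sub(2) \<open>s > 0\<close> by (auto simp: partitions_of_def intro: less_le_trans)
      ultimately show "P \<in> partitions_of n \<and> P \<noteq> {#} \<and> Min (set_mset P) = s \<and>
          Max (set_mset P) \<le> L + s \<and> k \<notin># P"
        using sP bnd(3) by auto
    qed
  qed
  finally have F: "(\<Sum>j | 1 \<le> j \<and> j * s \<le> n. c (n - j * s)) \<le> num_f L s k n" .

  have fin: "finite {x. x * a \<le> n}" if "a > 0" for a
  proof (rule finite_subset)
    show "{x. x * a \<le> n} \<subseteq> {..n}"
      using that by (auto intro: order_trans[rotated])
  qed simp
  define M where "M = {m. 1 \<le> m \<and> m * k \<le> n}"
  have finM: "finite M"
    unfolding M_def using fin[OF \<open>k > 0\<close>] by (rule rev_finite_subset) auto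
  have jJ: "J < j m" if "m \<in> M" for m
  proof -
    have "1 * k \<le> m * k" using that unfolding M_def by (intro mult_le_mono1) simp
    then have "s * (J + 2) \<le> m * k" using k by linarith
    then have "J + 2 \<le> m * k div s"
      using \<open>s > 0\<close> by (simp add: less_eq_div_iff_mult_less_eq mult.commute)
    then show ?thesis unfolding j_def by auto
  qed
  have jc: "j m * s \<le> n \<and> c (n - m * k) \<le> c (n - j m * s)" if m: "m \<in> M" for m
  proof (cases "s dvd m * k")
    case True
    then show ?thesis using m by (simp add: j_def M_def)
  next
    case False
    define z where "z = s + m * k mod s"
    have "m * k mod s > 0" "m * k mod s < s"
      using False \<open>s > 0\<close> by (auto simp: dvd_eq_mod_eq_0)
    then have "z \<in> T" using k2 by (auto simp: z_def T_def)
    have "m * k div s = j m + 1" using jJ[OF m] False by (auto simp: j_def)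
    then have "m * k = j m * s + z"
      using div_mult_mod_eq[of "m * k" s] by (simp add: z_def algebra_simps)
    moreover have "m * k \<le> n" using m by (simp add: M_def)
    ultimately have "n - j m * s = (n - m * k) + z" "j m * s \<le> n" by simp_all
    then show ?thesis
      using card_parts_in_mono_add[OF T(1) \<open>z \<in> T\<close>] by (simp add: c_def)
  qed
  \<comment> \<open>As k \<ge> 2 s, successive quotients differ by at least 2, which outweighs a
    decrement in \<open>j m'\<close>.\<close>
  have mono: "j m < j m'" if "m < m'" "m \<in> M" for m m'
  proof -
    have "m * k + 2 * s \<le> (m + 1) * k" using k2 by simp
    also have "\<dots> \<le> m' * k" using that by (intro mult_le_mono1) simp
    finally have "(m * k + 2 * s) div s \<le> m' * k div s" by (rule div_le_mono)
    then have "m * k div s + 2 \<le> m' * k div s" using \<open>s > 0\<close> by simp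
    then show ?thesis by (auto simp: j_def)
  qed
  have inj: "inj_on j M"
    by (rule inj_onI) (metis mono less_irrefl linorder_neqE_nat)

  have "{m. m * k \<le> n} = insert 0 M" by (auto simp: M_def Suc_le_eq)
  then have "num_c2 L s n = c n + (\<Sum>m\<in>M. c (n - m * k))"
    unfolding C using finM by (simp add: M_def)
  also have "c n \<le> (\<Sum>j | j \<in> {1..J} \<and> j * s \<le> n. c (n - j * s))"
    unfolding c_def T(5) J_def by (rule card_parts_in_le_sum) (use assms in auto)
  also have "(\<Sum>m\<in>M. c (n - m * k)) \<le> (\<Sum>m\<in>M. c (n - j m * s))"
    using jc by (intro sum_mono) blast
  also have "\<dots> = (\<Sum>i\<in>j ` M. c (n - i * s))"
    by (simp add: sum.reindex[OF inj])
  \<comment> \<open>The indices up to \<open>J\<close> serve \<open>c n\<close> and those in the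
    image of \<open>j\<close> exceed \<open>J\<close>, so no term is used twice.\<close>
  also have "(\<Sum>j | j \<in> {1..J} \<and> j * s \<le> n. c (n - j * s)) + (\<Sum>i\<in>j ` M. c (n - i * s)) =
      (\<Sum>i\<in>{j. j \<in> {1..J} \<and> j * s \<le> n} \<union> j ` M. c (n - i * s))"
    using jJ finM by (intro sum.union_disjoint[symmetric]) (auto simp: not_le[symmetric])
  also have "\<dots> \<le> (\<Sum>j | 1 \<le> j \<and> j * s \<le> n. c (n - j * s))"
  proof (rule sum_mono2)
    show "finite {j. 1 \<le> j \<and> j * s \<le> n}"
      using fin[OF \<open>s > 0\<close>] by (rule rev_finite_subset) auto
    show "{j. j \<in> {1..J} \<and> j * s \<le> n} \<union> j ` M \<subseteq> {j. 1 \<le> j \<and> j * s \<le> n}"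
      using jJ jc by fastforce
  qed simp
  also note F
  finally show ?thesis by simp
qed

end
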